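(* Let $(\mathcal X,m)$ be a metric space, $\mu$ a finite positive Borel measure supported on $\mathcal X$, and $X_N=\{x_1,\dots,x_N\}$ a set of $N$ points independently and randomly distributed over $\mathcal X$ with respect to $\mu$. Suppose $\Phi$ is a continuous non-negative strictly increasing function on $(0,\infty)$ satisfying $\Phi(r)\to 0$ as $r\to0^+$. If there exists a positive number $r_0$ such that $\mu(B(x,r))\geq \Phi(r)$ holds for all $x\in\mathcal X$ and every $0<r<r_0$, then there exist positive constants $c_1,c_2,c_3$ and $\alpha_0$ (not depending on $N$) such that for any $\alpha>\alpha_0$ and every $N\ge 2$ for which $\frac{\alpha\log N}{N}$ lies in the range of $\Phi$, $$\mathbb P\left[\rho(X_N,\mathcal X)\geq c_1\Phi^{-1}\left(\frac{\alpha\log N}{N}\right)\right]\leq c_2N^{1-c_3\alpha}.$$ If, in addition, $\Phi$ satisfies $\Phi(r)\leq r^\sigma$ for all small $r>0$ and some positive number $\sigma$, then there exist positive constants $c_1,c_2$ (not depending on $N$) such that for all sufficiently large $N$ $$\mathbb E\rho(X_N,\mathcal X)\leq c_1\Phi^{-1}\left(c_2\frac{\log N}{N}\right).$$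
   Context: $B(x,r)=\{y\in\mathcal X: m(y,x)\le r\}$ denotes the closed ball. The covering radius of $X_N$ with respect to $\mathcal X$ is $\rho(X_N,\mathcal X):=\sup_{y\in\mathcal X}\inf_{j} m(y,x_j)$. A point is randomly distributed over $\mathcal X$ with respect to $\mu$ if its law is the probability measure $\mu/\mu(\mathcal X)$. $\mathbb P$ and $\mathbb E$ denote probability and expectation with respect to the random choice of $X_N$. $\Phi^{-1}$ is the inverse of $\Phi$, defined on the range of $\Phi$. *)

theory Defs
  imports "HOL-Probability.Probability"
begin

(* The metric space is the whole type 'a, i.e. the ambient set below is UNIV in the theorem.
   Values are extended nonnegative reals, so the supremum needs no boundedness proviso. *)
definition covering_radius :: "'a::metric_space set \<Rightarrow> 'a set \<Rightarrow> ennreal" where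
  "covering_radius A Y = (SUP y\<in>Y. INF a\<in>A. ennreal (dist y a))"

(* x 1, ..., x N are random points on the probability space P, independent and each
   with law \<mu> / \<mu>(UNIV). Measurability of each x i is part of indep_vars. *)
definition iid_points ::
  "'a::metric_space measure \<Rightarrow> nat \<Rightarrow> 'w measure \<Rightarrow> (nat \<Rightarrow> 'w \<Rightarrow> 'a) \<Rightarrow> bool" where
  "iid_points \<mu> N P x \<longleftrightarrow>
     prob_space P \<and>
     prob_space.indep_vars P (\<lambda>_. borel) x {1..N} \<and>
     (\<forall>i\<in>{1..N}. distr P borel (x i) = scale_measure (1 / emeasure \<mu> UNIV) \<mu>)"

(* The random variable \<rho>(X_N, X). If \<mu>(cball z r) \<ge> \<Phi>(r) > 0 for all z and all small r, with \<mu>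
   finite, then the space is totally bounded, hence separable, so the supremum can be taken
   over a countable dense set and this is a measurable function of \<omega>. *)
definition random_covering_radius ::
  "(nat \<Rightarrow> 'w \<Rightarrow> 'a::metric_space) \<Rightarrow> nat \<Rightarrow> 'w \<Rightarrow> ennreal" where
  "random_covering_radius x N \<omega> = covering_radius ((\<lambda>i. x i \<omega>) ` {1..N}) UNIV"

(* Inverse of \<Phi> restricted to (0, \<infinity>); meaningful only on the range \<Phi> ` {0<..}. *)
definition pos_inv :: "(real \<Rightarrow> real) \<Rightarrow> real \<Rightarrow> real" where
  "pos_inv \<Phi> = the_inv_into {0<..} \<Phi>"

end

theory Submission imports Defs begin

text \<open>
  The argument is a union bound over a separated net. Fix a radius \<open>s\<close> at which every closed ball
  has mass at least \<open>p > 0\<close>, and let \<open>M\<close> be the total mass. A maximal set of points with mutual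
  distances above \<open>2 * s\<close> has at most \<open>M / p\<close> elements, because the balls of radius \<open>s\<close> around them
  are disjoint, and by maximality every point of the space lies within \<open>2 * s\<close> of it
  (\<open>separated_net_exists\<close>). If each of these balls contains a sample point, the covering radius is
  at most \<open>3 * s\<close>. One ball is missed by all \<open>N\<close> samples with probability at most
  \<open>(1 - p / M) ^ N \<le> exp (- N * p / M)\<close>, so the covering radius is at most \<open>3 * s\<close> off an event of
  probability at most \<open>M / p * exp (- N * p / M)\<close> (\<open>covering_radius_exceptional_event\<close>). With
  \<open>p = \<alpha> * ln N / N\<close> this is of order \<open>N powr (1 - \<alpha> / M)\<close> (\<open>covering_radius_tail\<close>).

  For the tail estimate take \<open>s = r\<close> with \<open>\<Phi> r = \<alpha> * ln N / N\<close>. The mass bound is available only for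
  \<open>r < r\<^sub>0\<close>. A larger \<open>r\<close> is harmless: the space has finite diameter, being a finite union of balls,
  and \<open>c\<^sub>1\<close> can be chosen so large that \<open>c\<^sub>1 * r\<^sub>0\<close> exceeds the diameter, which makes the event empty.

  For the expectation bound the covering radius by \<open>3 * r\<close> off the exceptional event and by the
  diameter on it. The hypothesis \<open>\<Phi> r \<le> r powr \<sigma>\<close> says that \<open>r\<close> decays no faster than a power,
  \<open>r \<ge> N powr (- 1 / \<sigma>)\<close>, so for \<open>\<alpha>\<close> large the contribution of the exceptional event is at most \<open>r\<close>.

  Both the event and the integrand of the theorem are dominated through the event that some ball of
  the net is missed, which is measurable since the net is finite; monotonicity of measure and
  integral does the rest.
\<close>

section \<open>Separated nets and the covering radius\<close>

text \<open>
  Packing: the balls of radius \<open>s\<close> about a set with mutual distances above \<open>2 * s\<close> are disjoint, so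
  their masses add up to at most the total mass. This bounds the cardinality of all such sets, hence
  one of maximal cardinality exists; a point farther than \<open>2 * s\<close> from it could be added.
\<close>

lemma separated_net_exists:
  fixes \<mu> :: "'a::metric_space measure"
  assumes borel: "sets \<mu> = sets borel" and "finite_measure \<mu>"
    and "p > 0" and mass: "\<And>z. measure \<mu> (cball z s) \<ge> p"
  obtains E :: "'a set" where "finite E" "real (card E) * p \<le> measure \<mu> UNIV" "\<And>y. \<exists>z\<in>E. dist y z \<le> 2 * s"
proof -
  interpret finite_measure \<mu> by fact
  define sep where "sep E \<longleftrightarrow> finite E \<and> (\<forall>x\<in>E. \<forall>y\<in>E. x \<noteq> y \<longrightarrow> 2 * s < dist x y)" for E :: "'a set"
  have [measurable]: "cball z s \<in> sets \<mu>" for z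
    unfolding borel by simp
  have packing: "real (card E) * p \<le> measure \<mu> UNIV" if "sep E" for E
  proof -
    have "disjoint_family_on (\<lambda>z. cball z s) E"
      unfolding disjoint_family_on_def
    proof (intro ballI impI)
      fix x y assume xy: "x \<in> E" "y \<in> E" "x \<noteq> y"
      then have "2 * s < dist x y" using that by (auto simp: sep_def)
      moreover have "dist x y \<le> 2 * s" if "w \<in> cball x s" "w \<in> cball y s" for w
        using that dist_triangle2[of x y w] by simp
      ultimately show "cball x s \<inter> cball y s = {}" by force
    qed
    then have "measure \<mu> (\<Union>z\<in>E. cball z s) = (\<Sum>z\<in>E. measure \<mu> (cball z s))"
      using that by (intro finite_measure_finite_Union) (auto simp: sep_def)
    moreover have "real (card E) * p \<le> (\<Sum>z\<in>E. measure \<mu> (cball z s))"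
      using sum_mono[where K = E, OF mass] by simp
    moreover have "measure \<mu> (\<Union>z\<in>E. cball z s) \<le> measure \<mu> UNIV"
      using borel by (intro finite_measure_mono) auto
    ultimately show ?thesis by simp
  qed
  have bound: "card E \<le> nat \<lceil>measure \<mu> UNIV / p\<rceil>" if "sep E" for E
  proof -
    have "real (card E) \<le> measure \<mu> UNIV / p"
      using packing[OF that] \<open>p > 0\<close> by (simp add: field_simps)
    then show ?thesis by linarith
  qed
  have "sep {}" by (simp add: sep_def)
  moreover have "\<forall>E. sep E \<longrightarrow> card E < Suc (nat \<lceil>measure \<mu> UNIV / p\<rceil>)"
    using bound by (simp add: less_Suc_eq_le)
  ultimately obtain E where E: "sep E" and max: "\<And>F. sep F \<Longrightarrow> card F \<le> card E"
    using ex_has_greatest_nat[of sep "{}" card "Suc (nat \<lceil>measure \<mu> UNIV / p\<rceil>)"] by blast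
  have "\<exists>z\<in>E. dist y z \<le> 2 * s" for y
  proof (rule ccontr)
    assume far: "\<not> (\<exists>z\<in>E. dist y z \<le> 2 * s)"
    show False
    proof (cases "y \<in> E")
      case True
      \<comment> \<open>Closed balls of negative radius are empty, so positive mass forces \<open>s \<ge> 0\<close>.\<close>
      have "0 \<le> s" using mass[of y] \<open>p > 0\<close> by (cases "s < 0") auto
      then show False using far True by force
    next
      case False
      have "sep (insert y E)" using far E by (auto simp: sep_def dist_commute not_le)
      then show False using max[of "insert y E"] False E by (auto simp: sep_def)
    qed
  qed
  with E packing[OF E] show thesis by (intro that[of E]) (auto simp: sep_def)
qed

lemma bounded_if_balls_have_mass:
  fixes \<mu> :: "'a::metric_space measure"
  assumes "sets \<mu> = sets borel" "finite_measure \<mu>" "p > 0" "\<And>z. measure \<mu> (cball z s) \<ge> p"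
  obtains D where "D > 0" "\<And>x y :: 'a. dist x y \<le> D"
proof -
  obtain E where E: "finite E" "\<And>y :: 'a. \<exists>z\<in>E. dist y z \<le> 2 * s"
    using separated_net_exists[OF assms] by metis
  have "bounded (\<Union>z\<in>E. cball z (2 * s))" using E by (intro bounded_UN) auto
  moreover have "(\<Union>z\<in>E. cball z (2 * s)) = UNIV" using E by (force simp: dist_commute)
  ultimately have "bounded (UNIV :: 'a set)" by simp
  then obtain D where "\<And>x y :: 'a. dist x y \<le> D"
    by (auto simp only: bounded_two_points)
  then show thesis by (intro that[of "max D 1"]) (auto simp: le_max_iff_disj)
qed

text \<open>
  Triangle inequality through a net point: \<open>2 * s\<close> from \<open>y\<close> to the net, \<open>s\<close> from the net to \<open>A\<close>.
\<close>

lemma covering_radius_le: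
  assumes net: "\<And>y. \<exists>z\<in>E. dist y z \<le> 2 * s" and hit: "\<And>z. z \<in> E \<Longrightarrow> \<exists>a\<in>A. dist z a \<le> s"
  shows "covering_radius A UNIV \<le> ennreal (3 * s)"
  unfolding covering_radius_def
proof (rule SUP_least)
  fix y
  obtain z where z: "z \<in> E" "dist y z \<le> 2 * s" using net by blast
  obtain a where a: "a \<in> A" "dist z a \<le> s" using hit z by blast
  have "dist y a \<le> 3 * s" using z a dist_triangle[of y a z] by linarith
  then show "(INF a\<in>A. ennreal (dist y a)) \<le> ennreal (3 * s)"
    using a(1) by (intro INF_lower2[of a]) (auto intro: ennreal_leI)
qed

lemma covering_radius_le_diameter:
  fixes A :: "'a::metric_space set"
  assumes "A \<noteq> {}" "\<And>x y :: 'a. dist x y \<le> D"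
  shows "covering_radius A UNIV \<le> ennreal D"
proof -
  obtain a where "a \<in> A" using assms(1) by blast
  then show ?thesis unfolding covering_radius_def
    by (intro SUP_least INF_lower2[of a]) (auto intro: ennreal_leI assms(2))
qed

section \<open>The exceptional event\<close>

text \<open>
  By independence the probability is the \<open>N\<close>-th power of the probability that one sample misses the
  ball; the exponential form comes from \<open>1 - u \<le> exp (- u)\<close>.
\<close>

lemma iid_points_miss_ball:
  fixes \<mu> :: "'a::metric_space measure"
  assumes borel: "sets \<mu> = sets borel" and fin: "finite_measure \<mu>" and pos: "measure \<mu> UNIV > 0"
    and iid: "iid_points \<mu> N P x" and mass: "measure \<mu> (cball z s) \<ge> p"
  shows "{\<omega> \<in> space P. \<forall>i\<in>{1..N}. x i \<omega> \<notin> cball z s} \<in> sets P"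
    and "measure P {\<omega> \<in> space P. \<forall>i\<in>{1..N}. x i \<omega> \<notin> cball z s}
           \<le> exp (- (real N * p / measure \<mu> UNIV))"
proof -
  interpret \<mu>: finite_measure \<mu> by fact
  interpret prob_space P using iid by (simp add: iid_points_def)
  let ?M = "measure \<mu> UNIV"
  have indep: "indep_vars (\<lambda>_. borel) x {1..N}"
    and law: "\<And>i. i \<in> {1..N} \<Longrightarrow> distr P borel (x i) = scale_measure (1 / emeasure \<mu> UNIV) \<mu>"
    using iid by (auto simp: iid_points_def)
  have [measurable]: "x i \<in> borel_measurable P" if "i \<in> {1..N}" for i
    using indep that by (auto simp: indep_vars_def)
  have [measurable]: "cball z s \<in> sets borel" by simp
  show "{\<omega> \<in> space P. \<forall>i\<in>{1..N}. x i \<omega> \<notin> cball z s} \<in> sets P"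
    by measurable
  have hit: "prob (x i -` cball z s \<inter> space P) = measure \<mu> (cball z s) / ?M" if "i \<in> {1..N}" for i
  proof -
    have "ennreal (prob (x i -` cball z s \<inter> space P)) = emeasure (distr P borel (x i)) (cball z s)"
      using that by (subst emeasure_distr) (auto simp: emeasure_eq_measure)
    also have "\<dots> = 1 / emeasure \<mu> UNIV * emeasure \<mu> (cball z s)"
      using that by (simp add: law)
    also have "\<dots> = ennreal (measure \<mu> (cball z s) / ?M)"
      using pos by (simp add: \<mu>.emeasure_eq_measure divide_ennreal ennreal_mult[symmetric]
          flip: ennreal_1)
    finally show ?thesis using pos by (simp add: measure_nonneg)
  qed
  have miss: "prob (x i -` (- cball z s) \<inter> space P) \<le> exp (- (p / ?M))" if "i \<in> {1..N}" for i
  proof -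
    have "x i -` (- cball z s) \<inter> space P = space P - (x i -` cball z s \<inter> space P)" by auto
    then have "prob (x i -` (- cball z s) \<inter> space P) = 1 - measure \<mu> (cball z s) / ?M"
      using that by (subst hit[OF that, symmetric]) (simp add: prob_compl)
    also have "\<dots> \<le> 1 - p / ?M" using mass pos by (simp add: divide_right_mono)
    also have "\<dots> \<le> exp (- (p / ?M))" using exp_ge_add_one_self[of "- (p / ?M)"] by simp
    finally show ?thesis .
  qed
  show "prob {\<omega> \<in> space P. \<forall>i\<in>{1..N}. x i \<omega> \<notin> cball z s} \<le> exp (- (real N * p / ?M))"
  proof (cases "N = 0")
    \<comment> \<open>An intersection over the empty index set would be \<open>UNIV\<close> instead of \<open>space P\<close>.\<close>
    case True
    then show ?thesis by (simp add: prob_space)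
  next
    case False
    have "prob {\<omega> \<in> space P. \<forall>i\<in>{1..N}. x i \<omega> \<notin> cball z s}
        = prob (\<Inter>i\<in>{1..N}. x i -` (- cball z s) \<inter> space P)"
      using False by (intro arg_cong[where f = prob]) force
    also have "\<dots> = (\<Prod>i\<in>{1..N}. prob (x i -` (- cball z s) \<inter> space P))"
      using False indep by (intro indep_varsD_finite) auto
    also have "\<dots> \<le> (\<Prod>i\<in>{1..N}. exp (- (p / ?M)))"
      using miss by (intro prod_mono) auto
    also have "\<dots> = exp (- (real N * p / ?M))"
      by (simp add: exp_of_nat_mult[symmetric])
    finally show ?thesis .
  qed
qed

text \<open>
  The event \<open>B\<close> is that some ball about a point of the finite net is missed by every sample. An
  explicit measurable \<open>B\<close> is produced, instead of a bound on the probability that the covering radius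
  exceeds \<open>3 * s\<close>, because it also serves to estimate the expectation.
\<close>

lemma covering_radius_exceptional_event:
  fixes \<mu> :: "'a::metric_space measure"
  assumes borel: "sets \<mu> = sets borel" and fin: "finite_measure \<mu>" and pos: "measure \<mu> UNIV > 0"
    and iid: "iid_points \<mu> N P x" and "p > 0" and mass: "\<And>z. measure \<mu> (cball z s) \<ge> p"
  obtains B where "B \<in> sets P"
    "measure P B \<le> measure \<mu> UNIV / p * exp (- (real N * p / measure \<mu> UNIV))"
    "\<And>\<omega>. \<omega> \<in> space P \<Longrightarrow> \<omega> \<notin> B \<Longrightarrow> random_covering_radius x N \<omega> \<le> ennreal (3 * s)"
proof -
  interpret prob_space P using iid by (simp add: iid_points_def)
  obtain E where E: "finite E" "real (card E) * p \<le> measure \<mu> UNIV" "\<And>y :: 'a. \<exists>z\<in>E. dist y z \<le> 2 * s"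
    using separated_net_exists[OF borel fin \<open>p > 0\<close> mass] by metis
  define miss where "miss z = {\<omega> \<in> space P. \<forall>i\<in>{1..N}. x i \<omega> \<notin> cball z s}" for z :: 'a
  note miss = iid_points_miss_ball[OF borel fin pos iid mass, folded miss_def]
  have "measure P (\<Union>z\<in>E. miss z) \<le> (\<Sum>z\<in>E. measure P (miss z))"
    using E(1) miss(1) by (intro finite_measure_subadditive_finite) auto
  also have "\<dots> \<le> real (card E) * exp (- (real N * p / measure \<mu> UNIV))"
    using sum_mono[where K = E, OF miss(2)] by simp
  also have "\<dots> \<le> measure \<mu> UNIV / p * exp (- (real N * p / measure \<mu> UNIV))"
    using E(2) \<open>p > 0\<close> by (intro mult_right_mono) (auto simp: field_simps)
  finally have le: "measure P (\<Union>z\<in>E. miss z)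
      \<le> measure \<mu> UNIV / p * exp (- (real N * p / measure \<mu> UNIV))" .
  show thesis
  proof (rule that[OF _ le])
    show "(\<Union>z\<in>E. miss z) \<in> sets P" using E(1) miss(1) by auto
    fix \<omega> assume "\<omega> \<in> space P" "\<omega> \<notin> (\<Union>z\<in>E. miss z)"
    then show "random_covering_radius x N \<omega> \<le> ennreal (3 * s)"
      unfolding random_covering_radius_def
      by (intro covering_radius_le[OF E(3)]) (auto simp: miss_def)
  qed
qed

text \<open>
  The choice \<open>p = \<alpha> * ln N / N\<close> turns \<open>exp (- N * p / M)\<close> into a power of \<open>N\<close>; the remaining factor
  \<open>1 / p\<close> costs at most \<open>N / ln 2\<close>, since \<open>\<alpha> * ln N \<ge> ln 2\<close>.
\<close>

lemma exceptional_bound_at_log_scale: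
  fixes M \<alpha> :: real
  assumes "M > 0" "\<alpha> > 1" "N \<ge> 2"
  shows "M / (\<alpha> * ln (real N) / real N) * exp (- (real N * (\<alpha> * ln (real N) / real N) / M))
           \<le> M / ln 2 * real N powr (1 - 1 / M * \<alpha>)"
proof -
  have N: "real N > 0" "ln (real N) \<ge> ln 2" "ln (real N) > 0" using assms by auto
  have ln: "ln 2 \<le> \<alpha> * ln (real N)"
    using mult_mono[of 1 \<alpha> "ln 2" "ln (real N)"] assms N by auto
  have "M / (\<alpha> * ln (real N) / real N) \<le> M / ln 2 * real N"
    using ln assms N frac_le[of "M * real N" "M * real N" "ln 2" "\<alpha> * ln (real N)"] by simp
  moreover have "exp (- (real N * (\<alpha> * ln (real N) / real N) / M)) = real N powr (- (1 / M * \<alpha>))"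
    using N by (simp add: powr_def)
  ultimately have "M / (\<alpha> * ln (real N) / real N) * exp (- (real N * (\<alpha> * ln (real N) / real N) / M))
      \<le> M / ln 2 * real N * real N powr (- (1 / M * \<alpha>))"
    by (metis mult_right_mono powr_ge_zero)
  also have "\<dots> = M / ln 2 * real N powr (1 - 1 / M * \<alpha>)"
    using N by (simp add: powr_diff powr_minus field_simps)
  finally show ?thesis .
qed

lemma covering_radius_tail:
  fixes \<mu> :: "'a::metric_space measure"
  assumes borel: "sets \<mu> = sets borel" and fin: "finite_measure \<mu>" and pos: "measure \<mu> UNIV > 0"
    and iid: "iid_points \<mu> N P x" and "\<alpha> > 1" "N \<ge> 2"
    and mass: "\<And>z. measure \<mu> (cball z s) \<ge> \<alpha> * ln (real N) / real N"
  obtains B where "B \<in> sets P"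
    "measure P B \<le> measure \<mu> UNIV / ln 2 * real N powr (1 - 1 / measure \<mu> UNIV * \<alpha>)"
    "\<And>\<omega>. \<omega> \<in> space P \<Longrightarrow> \<omega> \<notin> B \<Longrightarrow> random_covering_radius x N \<omega> \<le> ennreal (3 * s)"
proof -
  have "\<alpha> * ln (real N) / real N > 0" using \<open>\<alpha> > 1\<close> \<open>N \<ge> 2\<close> by simp
  then obtain B where B: "B \<in> sets P"
    "measure P B \<le> measure \<mu> UNIV / (\<alpha> * ln (real N) / real N)
        * exp (- (real N * (\<alpha> * ln (real N) / real N) / measure \<mu> UNIV))"
    "\<And>\<omega>. \<omega> \<in> space P \<Longrightarrow> \<omega> \<notin> B \<Longrightarrow> random_covering_radius x N \<omega> \<le> ennreal (3 * s)"
    using covering_radius_exceptional_event[OF borel fin pos iid _ mass] by blast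
  from B(2) exceptional_bound_at_log_scale[OF pos \<open>\<alpha> > 1\<close> \<open>N \<ge> 2\<close>]
  have "measure P B \<le> measure \<mu> UNIV / ln 2 * real N powr (1 - 1 / measure \<mu> UNIV * \<alpha>)"
    by (rule order_trans)
  with B(1) show thesis using B(3) by (rule that)
qed

text \<open>
  The majorant \<open>R + D * indicator B\<close> is measurable, so its integral can be computed; \<open>f\<close> is compared
  with it by monotonicity of the integral alone.
\<close>

lemma nn_integral_le_off_event:
  assumes "prob_space P" "B \<in> sets P" "measure P B \<le> b" "D \<ge> 0" "R \<ge> 0"
    and good: "\<And>\<omega>. \<omega> \<in> space P \<Longrightarrow> \<omega> \<notin> B \<Longrightarrow> f \<omega> \<le> ennreal R"
    and bad: "\<And>\<omega>. \<omega> \<in> space P \<Longrightarrow> f \<omega> \<le> ennreal D"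
  shows "(\<integral>\<^sup>+ \<omega>. f \<omega> \<partial>P) \<le> ennreal (R + D * b)"
proof -
  interpret prob_space P by fact
  have "b \<ge> 0" using assms(3) measure_nonneg order_trans by blast
  have "(\<integral>\<^sup>+ \<omega>. f \<omega> \<partial>P) \<le> (\<integral>\<^sup>+ \<omega>. ennreal R + ennreal D * indicator B \<omega> \<partial>P)"
    using good bad by (intro nn_integral_mono) (auto simp: indicator_def add_increasing)
  also have "\<dots> = ennreal R + ennreal D * emeasure P B"
    using assms(2) by (simp add: nn_integral_add nn_integral_cmult_indicator emeasure_space_1)
  also have "\<dots> \<le> ennreal R + ennreal D * ennreal b"
    using assms(3) by (intro add_left_mono mult_left_mono) (auto simp: emeasure_eq_measure ennreal_leI)
  also have "\<dots> = ennreal (R + D * b)"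
    using assms \<open>b \<ge> 0\<close> by (simp add: ennreal_mult ennreal_plus)
  finally show ?thesis .
qed

section \<open>The inverse of the mass profile\<close>

lemma pos_inv_image:
  assumes "strict_mono_on {0<..} \<Phi>" "t \<in> \<Phi> ` {0<..}"
  shows "pos_inv \<Phi> t > 0" and "\<Phi> (pos_inv \<Phi> t) = t"
proof -
  have "inj_on \<Phi> {0<..}" using assms(1) by (rule strict_mono_on_imp_inj_on)
  then show "pos_inv \<Phi> t > 0" and "\<Phi> (pos_inv \<Phi> t) = t"
    unfolding pos_inv_def using assms(2) the_inv_into_into[of \<Phi> "{0<..}" t "{0<..}"]
    by (auto intro: f_the_inv_into_f)
qed

lemma small_values_in_range:
  fixes \<Phi> :: "real \<Rightarrow> real"
  assumes cont: "continuous_on {0<..} \<Phi>" and lim0: "(\<Phi> \<longlongrightarrow> 0) (at_right 0)"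
    and "\<delta> > 0" "0 < t" "t < \<Phi> \<delta>"
  shows "t \<in> \<Phi> ` {0<..}"
proof -
  have "\<forall>\<^sub>F r in at_right 0. \<Phi> r < t" using lim0 \<open>0 < t\<close> by (rule order_tendstoD)
  moreover have "\<forall>\<^sub>F r in at_right 0. r \<in> {0<..<\<delta>}" using \<open>\<delta> > 0\<close> by (rule eventually_at_right_real)
  ultimately have "\<exists>r. \<Phi> r < t \<and> r \<in> {0<..<\<delta>}"
    by (intro eventually_happens'[OF _ eventually_conj]) auto
  then obtain r where r: "\<Phi> r < t" "0 < r" "r < \<delta>" by auto
  have "\<exists>u\<ge>r. u \<le> \<delta> \<and> \<Phi> u = t"
    using r assms by (intro IVT') (auto intro: continuous_on_subset[OF cont])
  then show ?thesis using r by force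
qed

section \<open>Tail and expectation of the covering radius\<close>

theorem theorem2p1:
  fixes \<mu> :: "'a::metric_space measure" and \<Phi> :: "real \<Rightarrow> real" and r\<^sub>0 :: real
  assumes borel: "sets \<mu> = sets borel"
    and finite: "finite_measure \<mu>"
    and positive: "measure \<mu> UNIV > 0"
    and cont: "continuous_on {0<..} \<Phi>"
    and nonneg: "\<forall>r>0. \<Phi> r \<ge> 0"
    and incr: "strict_mono_on {0<..} \<Phi>"
    and lim0: "(\<Phi> \<longlongrightarrow> 0) (at_right 0)"
    and r0: "r\<^sub>0 > 0"
    and lower: "\<forall>z. \<forall>r. 0 < r \<and> r < r\<^sub>0 \<longrightarrow> measure \<mu> (cball z r) \<ge> \<Phi> r"
  shows
    "(\<exists>c\<^sub>1>0. \<exists>c\<^sub>2>0. \<exists>c\<^sub>3>0. \<exists>\<alpha>\<^sub>0>0. \<forall>\<alpha>>\<alpha>\<^sub>0. \<forall>N\<ge>2.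
        \<alpha> * ln (real N) / real N \<in> \<Phi> ` {0<..} \<longrightarrow>
        (\<forall>(P :: 'w measure) x. iid_points \<mu> N P x \<longrightarrow>
          measure P {\<omega> \<in> space P. random_covering_radius x N \<omega>
                        \<ge> ennreal (c\<^sub>1 * pos_inv \<Phi> (\<alpha> * ln (real N) / real N))}
            \<le> c\<^sub>2 * real N powr (1 - c\<^sub>3 * \<alpha>))) \<and>
     ((\<exists>\<sigma>>0. \<forall>\<^sub>F r in at_right 0. \<Phi> r \<le> r powr \<sigma>) \<longrightarrow>
      (\<exists>c\<^sub>1>0. \<exists>c\<^sub>2>0. \<forall>\<^sub>F N in sequentially.
        c\<^sub>2 * (ln (real N) / real N) \<in> \<Phi> ` {0<..} \<and>
        (\<forall>(P :: 'w measure) x. iid_points \<mu> N P x \<longrightarrow>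
          (\<integral>\<^sup>+ \<omega>. random_covering_radius x N \<omega> \<partial>P)
            \<le> ennreal (c\<^sub>1 * pos_inv \<Phi> (c\<^sub>2 * (ln (real N) / real N))))))"
proof -
  let ?M = "measure \<mu> UNIV"
  have \<Phi>_pos: "\<Phi> r > 0" if "r > 0" for r
  proof -
    have "\<Phi> (r / 2) < \<Phi> r" using incr that by (intro strict_mono_onD[OF incr]) auto
    moreover have "\<Phi> (r / 2) \<ge> 0" using nonneg that by simp
    ultimately show ?thesis by linarith
  qed
  have mass: "measure \<mu> (cball z r) \<ge> \<Phi> r" if "0 < r" "r < r\<^sub>0" for z r
    using lower that by blast
  obtain D where D: "D > 0" "\<And>x y :: 'a. dist x y \<le> D"
    using bounded_if_balls_have_mass[OF borel finite \<Phi>_pos[of "r\<^sub>0 / 2"] mass[of "r\<^sub>0 / 2"]] r0 by auto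
  have diam: "random_covering_radius x N \<omega> \<le> ennreal D" if "N \<ge> 2" for x :: "nat \<Rightarrow> 'w \<Rightarrow> 'a" and N \<omega>
    unfolding random_covering_radius_def using that D(2) by (intro covering_radius_le_diameter) auto

  have tail: "\<exists>c\<^sub>1>0. \<exists>c\<^sub>2>0. \<exists>c\<^sub>3>0. \<exists>\<alpha>\<^sub>0>0. \<forall>\<alpha>>\<alpha>\<^sub>0. \<forall>N\<ge>2.
        \<alpha> * ln (real N) / real N \<in> \<Phi> ` {0<..} \<longrightarrow>
        (\<forall>(P :: 'w measure) x. iid_points \<mu> N P x \<longrightarrow>
          measure P {\<omega> \<in> space P. random_covering_radius x N \<omega>
                        \<ge> ennreal (c\<^sub>1 * pos_inv \<Phi> (\<alpha> * ln (real N) / real N))}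
            \<le> c\<^sub>2 * real N powr (1 - c\<^sub>3 * \<alpha>))"
  proof -
    \<comment> \<open>The first entry gives \<open>c > 3\<close>, so that the net estimate contradicts the event strictly; the
      second makes \<open>c * r\<close> exceed the diameter as soon as \<open>r \<ge> r\<^sub>0\<close>.\<close>
    define c where "c = max 4 ((D + 1) / r\<^sub>0)"
    have c: "c \<ge> 4" "c * r\<^sub>0 \<ge> D + 1" using r0 by (auto simp: c_def field_simps max_def)
    have main: "measure P {\<omega> \<in> space P. random_covering_radius x N \<omega>
                        \<ge> ennreal (c * pos_inv \<Phi> (\<alpha> * ln (real N) / real N))}
            \<le> ?M / ln 2 * real N powr (1 - 1 / ?M * \<alpha>)"
      if \<alpha>: "\<alpha> > 1" and N: "N \<ge> 2" and range: "\<alpha> * ln (real N) / real N \<in> \<Phi> ` {0<..}"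
        and iid: "iid_points \<mu> N P x" for \<alpha> N and P :: "'w measure" and x
    proof -
      interpret prob_space P using iid by (simp add: iid_points_def)
      define r where "r = pos_inv \<Phi> (\<alpha> * ln (real N) / real N)"
      have r: "r > 0" "\<Phi> r = \<alpha> * ln (real N) / real N"
        using pos_inv_image[OF incr range] by (auto simp: r_def)
      have "prob {\<omega> \<in> space P. random_covering_radius x N \<omega> \<ge> ennreal (c * r)}
            \<le> ?M / ln 2 * real N powr (1 - 1 / ?M * \<alpha>)"
      proof (cases "r < r\<^sub>0")
        case True
        obtain B where B: "B \<in> sets P" "prob B \<le> ?M / ln 2 * real N powr (1 - 1 / ?M * \<alpha>)"
          "\<And>\<omega>. \<omega> \<in> space P \<Longrightarrow> \<omega> \<notin> B \<Longrightarrow> random_covering_radius x N \<omega> \<le> ennreal (3 * r)"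
          using covering_radius_tail[OF borel finite positive iid \<alpha> N] mass[OF r(1) True] r(2) by metis
        have "ennreal (3 * r) < ennreal (c * r)"
          using c r by (intro ennreal_lessI) auto
        then have "{\<omega> \<in> space P. random_covering_radius x N \<omega> \<ge> ennreal (c * r)} \<subseteq> B"
          using B(3) by (force simp: not_le[symmetric])
        then show ?thesis using B(1,2) finite_measure_mono by (meson order_trans)
      next
        case False
        have "D < c * r" using c False mult_left_mono[of "r\<^sub>0" r c] by linarith
        then have "ennreal D < ennreal (c * r)" using D(1) by (intro ennreal_lessI) auto
        then have "{\<omega> \<in> space P. random_covering_radius x N \<omega> \<ge> ennreal (c * r)} = {}"
          using diam[OF N, of x] by (auto simp: not_le intro: le_less_trans)
        then show ?thesis using positive by (simp only: measure_empty) auto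
      qed
      then show ?thesis by (simp only: r_def)
    qed
    have "c > 0" "?M / ln 2 > 0" "1 / ?M > 0" "(1::real) > 0" using c positive by auto
    note constants = this
    show ?thesis
      by (rule exI[of _ c], rule conjI[OF constants(1)], rule exI[of _ "?M / ln 2"],
          rule conjI[OF constants(2)], rule exI[of _ "1 / ?M"], rule conjI[OF constants(3)],
          rule exI[of _ 1], rule conjI[OF constants(4)]) (intro allI impI main)
  qed

  moreover have "\<exists>c\<^sub>1>0. \<exists>c\<^sub>2>0. \<forall>\<^sub>F N in sequentially.
        c\<^sub>2 * (ln (real N) / real N) \<in> \<Phi> ` {0<..} \<and>
        (\<forall>(P :: 'w measure) x. iid_points \<mu> N P x \<longrightarrow>
          (\<integral>\<^sup>+ \<omega>. random_covering_radius x N \<omega> \<partial>P)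
            \<le> ennreal (c\<^sub>1 * pos_inv \<Phi> (c\<^sub>2 * (ln (real N) / real N))))"
    if "\<sigma> > 0" and small: "\<forall>\<^sub>F r in at_right 0. \<Phi> r \<le> r powr \<sigma>" for \<sigma>
  proof -
    obtain \<delta>' where "\<delta>' > 0" and \<delta>': "\<And>r. 0 < r \<Longrightarrow> r < \<delta>' \<Longrightarrow> \<Phi> r \<le> r powr \<sigma>"
      using small unfolding eventually_at_right_field by auto
    define \<delta> where "\<delta> = min \<delta>' r\<^sub>0"
    have \<delta>: "\<delta> > 0" "\<delta> \<le> \<delta>'" "\<delta> \<le> r\<^sub>0" using \<open>\<delta>' > 0\<close> r0 by (auto simp: \<delta>_def)
    \<comment> \<open>This makes the exceptional probability \<open>O(N powr (- 1 - 1 / \<sigma>))\<close>: the power \<open>N powr (- 1 / \<sigma>)\<close> is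
      a lower bound for \<open>r\<close>, and the spare factor \<open>1 / N\<close> absorbs the constants.\<close>
    define \<alpha> where "\<alpha> = ?M * (2 + 1 / \<sigma>) + 1"
    have \<alpha>: "\<alpha> > 1" "1 - 1 / ?M * \<alpha> \<le> - 1 - 1 / \<sigma>"
      using positive \<open>\<sigma> > 0\<close> by (auto simp: \<alpha>_def field_simps add_pos_pos)
    have "((\<lambda>N. \<alpha> * (ln (real N) / real N)) \<longlongrightarrow> 0) sequentially"
      using tendsto_mult_right_zero lim_ln_over_n by blast
    then have "\<forall>\<^sub>F N in sequentially. \<alpha> * (ln (real N) / real N) < \<Phi> \<delta>"
      using \<Phi>_pos[OF \<delta>(1)] by (rule order_tendstoD)
    moreover have "\<forall>\<^sub>F N in sequentially. N \<ge> max 3 (nat \<lceil>D * (?M / ln 2)\<rceil>)"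
      by (rule eventually_ge_at_top)
    ultimately have "\<forall>\<^sub>F N in sequentially.
        \<alpha> * (ln (real N) / real N) \<in> \<Phi> ` {0<..} \<and>
        (\<forall>(P :: 'w measure) x. iid_points \<mu> N P x \<longrightarrow>
          (\<integral>\<^sup>+ \<omega>. random_covering_radius x N \<omega> \<partial>P)
            \<le> ennreal (4 * pos_inv \<Phi> (\<alpha> * (ln (real N) / real N))))"
    proof (eventually_elim, intro conjI allI impI)
      fix N :: nat
      assume t: "\<alpha> * (ln (real N) / real N) < \<Phi> \<delta>" and large: "max 3 (nat \<lceil>D * (?M / ln 2)\<rceil>) \<le> N"
      then have N: "N \<ge> 3" "N \<ge> 2" "D * (?M / ln 2) \<le> real N" by (auto simp: nat_le_iff) linarith
      have ln: "ln (real N) \<ge> 1"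
        using N exp_le by (subst ln_ge_iff) (auto intro: order_trans)
      show range: "\<alpha> * (ln (real N) / real N) \<in> \<Phi> ` {0<..}"
        using N \<alpha> ln by (intro small_values_in_range[OF cont lim0 \<delta>(1) _ t]) auto
      define r where "r = pos_inv \<Phi> (\<alpha> * (ln (real N) / real N))"
      have r: "r > 0" "\<Phi> r = \<alpha> * ln (real N) / real N"
        using pos_inv_image[OF incr range] by (auto simp: r_def)
      have "r < \<delta>"
      proof (rule ccontr)
        assume "\<not> r < \<delta>"
        then have "\<Phi> \<delta> \<le> \<Phi> r" using \<delta>(1) r(1)
          by (intro monotone_onD[OF strict_mono_on_imp_mono_on[OF incr]]) auto
        then show False using t r(2) by simp
      qed
      then have r_small: "r < \<delta>'" "r < r\<^sub>0" using \<delta> by auto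
      \<comment> \<open>Since \<open>\<alpha> * ln N \<ge> 1\<close>, already \<open>1 / N \<le> \<Phi> r \<le> r powr \<sigma>\<close>.\<close>
      have r_large: "real N powr (- (1 / \<sigma>)) \<le> r"
      proof -
        have "1 / real N \<le> \<alpha> * ln (real N) / real N"
          using \<alpha>(1) ln mult_mono[of 1 \<alpha> 1 "ln (real N)"] by (intro divide_right_mono) auto
        then have "1 / real N \<le> r powr \<sigma>" using \<delta>'[OF r(1) r_small(1)] r(2) by simp
        then have "(1 / real N) powr (1 / \<sigma>) \<le> (r powr \<sigma>) powr (1 / \<sigma>)"
          using \<open>\<sigma> > 0\<close> by (intro powr_mono2) auto
        then show ?thesis using \<open>\<sigma> > 0\<close> r(1) N by (simp add: powr_powr powr_divide powr_minus_divide)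
      qed
      have err: "D * (?M / ln 2 * real N powr (1 - 1 / ?M * \<alpha>)) \<le> r"
      proof -
        have "D * (?M / ln 2 * real N powr (1 - 1 / ?M * \<alpha>)) = D * (?M / ln 2) * real N powr (1 - 1 / ?M * \<alpha>)"
          by simp
        also have "\<dots> \<le> real N * real N powr (- 1 - 1 / \<sigma>)"
          using N \<alpha>(2) by (intro mult_mono powr_mono) auto
        also have "\<dots> = real N powr (- (1 / \<sigma>))"
          using N by (simp add: powr_diff powr_minus field_simps)
        finally show ?thesis using r_large by linarith
      qed
      fix P :: "'w measure" and x assume iid: "iid_points \<mu> N P x"
      then have P: "prob_space P" by (simp add: iid_points_def)
      obtain B where B: "B \<in> sets P" "measure P B \<le> ?M / ln 2 * real N powr (1 - 1 / ?M * \<alpha>)"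
          "\<And>\<omega>. \<omega> \<in> space P \<Longrightarrow> \<omega> \<notin> B \<Longrightarrow> random_covering_radius x N \<omega> \<le> ennreal (3 * r)"
        using covering_radius_tail[OF borel finite positive iid \<alpha>(1) N(2)] mass[OF r(1) r_small(2)] r(2) by metis
      have "(\<integral>\<^sup>+ \<omega>. random_covering_radius x N \<omega> \<partial>P)
          \<le> ennreal (3 * r + D * (?M / ln 2 * real N powr (1 - 1 / ?M * \<alpha>)))"
        using D(1) r(1) by (intro nn_integral_le_off_event[OF P B(1,2)] B(3) diam[OF N(2)]) auto
      also have "\<dots> \<le> ennreal (4 * r)" using err by (intro ennreal_leI) linarith
      finally show "(\<integral>\<^sup>+ \<omega>. random_covering_radius x N \<omega> \<partial>P)
            \<le> ennreal (4 * pos_inv \<Phi> (\<alpha> * (ln (real N) / real N)))" unfolding r_def .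
    qed
    with \<alpha>(1) show ?thesis
      by (intro exI[of _ 4] conjI exI[of _ \<alpha>]) simp_all
  qed
  ultimately show ?thesis by blast
qed

end
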